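(* There is a centrally symmetric set $P\subset\mathbb{Z}^2$ of exactly $96$ points ($P=-P$), with no three points of $P$ collinear, which has no orthogonal $8$-partition: $P$ cannot be partitioned into four cyclically ordered classes of sizes $8,8,40,40$ separated by two perpendicular lines. This remains true under the weak convention in which points lying on either cutting line may be assigned arbitrarily to adjacent sectors: for every pair of perpendicular lines in $\mathbb{R}^2$ and every assignment of the points of $P$ to the four sectors such that each point is assigned to a sector whose closure contains it, the numbers of points assigned to the four sectors are not, in any cyclic order of the sectors, equal to $8,8,40,40$.
   Context: For a set $P$ of $N=2m$ points in $\mathbb{R}^2$ and an integer $0\le k\le N/4$, an orthogonal $k$-partition is a partition of $P$ into four cyclically ordered classes of sizes $k,k,m-k,m-k$ separated by two perpendicular lines, that is, the classes are the sets of points of $P$ in the four sectors determined by the lines, in cyclic order around their intersection. In the strict sense the two lines avoid all points of $P$; in the weak sense points on the lines are allowed and each may be assigned to any of its incident sectors. Here $m=48$, $k=8$. *)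

theory Defs
  imports "HOL-Analysis.Analysis"
begin

definition integer_lattice :: "(real^2) set" where
  "integer_lattice = {x. \<forall>i. x $ i \<in> \<int>}"

definition line_through :: "real^2 \<Rightarrow> real^2 \<Rightarrow> (real^2) set" where
  "line_through p u = range (\<lambda>t. p + t *\<^sub>R u)"

text \<open>A pair of perpendicular lines is given by its intersection point \<open>p\<close> and by nonzero
  orthogonal directions \<open>u\<close>, \<open>v\<close>. The four half-lines issuing from \<open>p\<close> have the directions
  \<open>u, v, -u, -v\<close>, in this cyclic order, and the open sector number \<open>j\<close> (read modulo 4) lies
  between the half-lines number \<open>j\<close> and \<open>j + 1\<close>.\<close>

definition perp_directions :: "real^2 \<Rightarrow> real^2 \<Rightarrow> bool" where
  "perp_directions u v \<longleftrightarrow> u \<noteq> 0 \<and> v \<noteq> 0 \<and> orthogonal u v"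

definition ray_dir :: "real^2 \<Rightarrow> real^2 \<Rightarrow> nat \<Rightarrow> real^2" where
  "ray_dir u v j = [u, v, - u, - v] ! (j mod 4)"

definition sector :: "real^2 \<Rightarrow> real^2 \<Rightarrow> real^2 \<Rightarrow> nat \<Rightarrow> (real^2) set" where
  "sector p u v j =
     {p + s *\<^sub>R ray_dir u v j + t *\<^sub>R ray_dir u v (j + 1) | s t. s > 0 \<and> t > 0}"

text \<open>The sizes \<open>c 0, c 1, c 2, c 3\<close> of the four sectors are \<open>k, k, l, l\<close> when read cyclically
  from some starting sector. The orientation is immaterial: the reversal of \<open>k, k, l, l\<close>
  is one of its rotations.\<close>

definition cyclic_sizes :: "(nat \<Rightarrow> nat) \<Rightarrow> nat \<Rightarrow> nat \<Rightarrow> bool" where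
  "cyclic_sizes c k l \<longleftrightarrow>
     (\<exists>r<4. c r = k \<and> c ((r + 1) mod 4) = k \<and> c ((r + 2) mod 4) = l \<and> c ((r + 3) mod 4) = l)"

definition has_strict_orthogonal_partition :: "nat \<Rightarrow> (real^2) set \<Rightarrow> bool" where
  "has_strict_orthogonal_partition k P \<longleftrightarrow>
     (\<exists>p u v. perp_directions u v
        \<and> P \<inter> (line_through p u \<union> line_through p v) = {}
        \<and> cyclic_sizes (\<lambda>j. card (P \<inter> sector p u v j)) k (card P div 2 - k))"

definition sector_assignment ::
  "(real^2) set \<Rightarrow> real^2 \<Rightarrow> real^2 \<Rightarrow> real^2 \<Rightarrow> (real^2 \<Rightarrow> nat) \<Rightarrow> bool" where
  "sector_assignment P p u v f \<longleftrightarrow> (\<forall>x\<in>P. f x < 4 \<and> x \<in> closure (sector p u v (f x)))"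

definition has_weak_orthogonal_partition :: "nat \<Rightarrow> (real^2) set \<Rightarrow> bool" where
  "has_weak_orthogonal_partition k P \<longleftrightarrow>
     (\<exists>p u v f. perp_directions u v
        \<and> sector_assignment P p u v f
        \<and> cyclic_sizes (\<lambda>j. card {x\<in>P. f x = j}) k (card P div 2 - k))"

end

theory Submission
  imports Defs "HOL-Number_Theory.Residues"
begin

text \<open>In a partition into cyclic classes of sizes \<open>k, k, m - k, m - k\<close> one of the two lines halves
  the set, and the other one cuts off a cap of \<open>2 k\<close> points, \<open>k\<close> on each side of the halving
  line. As \<open>P = - P\<close>, the halving line may be moved to the origin. So it suffices to find a
  chiral set for which in every direction \<open>w\<close> the cap of 16 extreme points has at least nine
  points to the left of the line through the origin in direction \<open>w\<close>. The set below, found by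
  simulated annealing, is also invariant under a quarter turn, so only the directions of one
  quadrant matter; this quadrant is covered by eleven cones, and in each of them the same nine
  points serve for all directions.

  The points lie on the circle \<open>x\<^sup>2 + y\<^sup>2 = 1\<close> modulo 199 and are distinct modulo 199. A line
  modulo 199 meets this circle at most twice, so no three of the points are collinear.\<close>

section \<open>From partitions to left-heavy directions\<close>

definition rot :: "real^2 \<Rightarrow> real^2" where
  "rot x = vector [- x $ 2, x $ 1]"

lemma rot_nth [simp]: "rot x $ 1 = - x $ 2" "rot x $ 2 = x $ 1"
  by (simp_all add: rot_def)

lemma inner_real2: "x \<bullet> y = x $ 1 * y $ 1 + x $ 2 * y $ 2" for x y :: "real^2"
  by (simp add: inner_vec_def sum_2)

lemma vec_eq_real2: "x = y \<longleftrightarrow> x $ 1 = y $ 1 \<and> x $ 2 = y $ 2" for x y :: "real^2"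
  by (simp add: vec_eq_iff forall_2)

lemma inner_rot [simp]: "rot x \<bullet> rot y = x \<bullet> y"
  by (simp add: inner_real2)

lemma inj_rot: "inj rot"
  by (rule injI) (simp add: vec_eq_real2)

text \<open>The strict and weak inequalities give every point on a cutting line to the side where it
  makes the condition harder to satisfy, as the weak partitions require.\<close>

definition left_heavy :: "nat \<Rightarrow> (real^2) set \<Rightarrow> real^2 \<Rightarrow> bool" where
  "left_heavy k P w \<longleftrightarrow>
     (\<forall>t. card {x\<in>P. 0 < rot w \<bullet> x \<and> t < w \<bullet> x} \<le> k
        \<longrightarrow> card {x\<in>P. rot w \<bullet> x \<le> 0 \<and> t \<le> w \<bullet> x} < k)"

text \<open>\<open>rot\<close> preserves inner products and permutes \<open>P\<close>, so it carries
  the points counted for \<open>w\<close> bijectively onto those counted for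
  \<open>rot w\<close>.\<close>

lemma left_heavy_rot:
  assumes "rot ` P = P"
  shows "left_heavy k P (rot w) \<longleftrightarrow> left_heavy k P w"
proof -
  have eq: "card {x\<in>P. Q (rot (rot w) \<bullet> x) (rot w \<bullet> x)} = card {x\<in>P. Q (rot w \<bullet> x) (w \<bullet> x)}" for Q
  proof -
    have "{x\<in>P. Q (rot (rot w) \<bullet> x) (rot w \<bullet> x)}
        = {x\<in>rot ` P. Q (rot (rot w) \<bullet> x) (rot w \<bullet> x)}"
      using assms by simp
    also have "\<dots> = rot ` {x\<in>P. Q (rot w \<bullet> x) (w \<bullet> x)}"
      by auto
    finally show ?thesis
      by (simp add: card_image inj_on_subset[OF inj_rot])
  qed
  show ?thesis
    unfolding left_heavy_def
    using eq[of "\<lambda>a b. 0 < a \<and> _ < b"] eq[of "\<lambda>a b. a \<le> 0 \<and> _ \<le> b"] by simp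
qed

lemma left_heavy_quadrant:
  assumes P: "rot ` P = P"
    and quadrant: "\<And>w. w \<noteq> 0 \<Longrightarrow> 0 \<le> w $ 1 \<Longrightarrow> 0 \<le> w $ 2 \<Longrightarrow> left_heavy k P w"
    and "w \<noteq> 0"
  shows "left_heavy k P w"
proof -
  have nz: "rot x \<noteq> 0" if "x \<noteq> 0" for x
    using that by (auto simp: vec_eq_real2)
  consider "0 \<le> w $ 1" "0 \<le> w $ 2" | "0 \<le> rot w $ 1" "0 \<le> rot w $ 2"
    | "0 \<le> rot (rot w) $ 1" "0 \<le> rot (rot w) $ 2"
    | "0 \<le> rot (rot (rot w)) $ 1" "0 \<le> rot (rot (rot w)) $ 2"
    by fastforce
  then show ?thesis
    by cases (use quadrant[of w] quadrant[of "rot w"] quadrant[of "rot (rot w)"]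
        quadrant[of "rot (rot (rot w))"] in \<open>simp_all add: \<open>w \<noteq> 0\<close> nz left_heavy_rot[OF P]\<close>)
qed

section \<open>Caps and halving lines of a centrally symmetric set\<close>

text \<open>This moves the halving line to the origin. If \<open>x\<close> lay in \<open>B\<close>,
  then \<open>c\<close> would be positive, so \<open>n\<close> would be positive on all of
  \<open>A\<close>. The antipodes of the points where \<open>n\<close> is positive lie in
  \<open>B\<close>, and together with \<open>x\<close> they would make \<open>B\<close> larger than
  \<open>A\<close>.\<close>

lemma halving_sides:
  fixes P :: "(real^2) set"
  assumes "finite P" "uminus ` P = P" "A \<union> B = P" "A \<inter> B = {}" "card A = card B"
    and A: "\<And>x. x \<in> A \<Longrightarrow> c \<le> n \<bullet> x" and B: "\<And>x. x \<in> B \<Longrightarrow> n \<bullet> x \<le> c"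
    and x: "x \<in> P" "0 < n \<bullet> x"
  shows "x \<in> A"
proof (rule ccontr)
  assume "x \<notin> A"
  with assms have "x \<in> B" by blast
  with B x have "0 < c" by fastforce
  have fin: "finite A" "finite B"
    using assms by auto
  have "card A \<le> card {y\<in>P. 0 < n \<bullet> y}"
    using assms(1,3) A \<open>0 < c\<close> by (intro card_mono) fastforce+
  also have "\<dots> = card (uminus ` {y\<in>P. 0 < n \<bullet> y})"
    by (simp add: card_image)
  also have "uminus ` {y\<in>P. 0 < n \<bullet> y} \<subseteq> B - {x}"
  proof
    fix z assume "z \<in> uminus ` {y\<in>P. 0 < n \<bullet> y}"
    then obtain y where "y \<in> P" "0 < n \<bullet> y" "z = - y" by blast
    then have "z \<in> P" "n \<bullet> z < 0"
      using assms(2) by auto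
    then show "z \<in> B - {x}"
      using A[of z] \<open>0 < c\<close> x assms(3) by auto
  qed
  then have "card (uminus ` {y\<in>P. 0 < n \<bullet> y}) \<le> card (B - {x})"
    using fin by (intro card_mono) auto
  also have "\<dots> < card B"
    using fin \<open>x \<in> B\<close> by (intro psubset_card_mono) auto
  finally show False
    using assms by simp
qed

text \<open>By \<open>halving_sides\<close>, every point strictly to the left of the origin line is
  in \<open>C1 \<union> C2\<close>. Those above \<open>t\<close> are then in \<open>C1\<close>,
  whereas \<open>C0\<close> lies weakly to the right, so the condition of \<open>left_heavy\<close>
  fails at the threshold \<open>t\<close>.\<close>

lemma cap_not_left_heavy:
  fixes P :: "(real^2) set"
  assumes P: "finite P" "uminus ` P = P" "C0 \<union> C1 \<union> C2 \<union> C3 = P"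
    and disj: "C0 \<inter> C1 = {}" "C0 \<inter> C2 = {}" "C0 \<inter> C3 = {}" "C1 \<inter> C2 = {}" "C1 \<inter> C3 = {}"
      "C2 \<inter> C3 = {}"
    and card: "card C0 = k" "card C1 = k" "card C2 = l" "card C3 = l"
    and upper: "\<And>x. x \<in> C0 \<union> C1 \<Longrightarrow> t \<le> w \<bullet> x" "\<And>x. x \<in> C2 \<union> C3 \<Longrightarrow> w \<bullet> x \<le> t"
    and left: "\<And>x. x \<in> C1 \<union> C2 \<Longrightarrow> c \<le> rot w \<bullet> x" "\<And>x. x \<in> C3 \<union> C0 \<Longrightarrow> rot w \<bullet> x \<le> c"
  shows "\<not> left_heavy k P w"
proof -
  have fin: "finite C0" "finite C1" "finite C2" "finite C3"
    using P by auto
  have L: "x \<in> C1 \<union> C2" if "x \<in> P" "0 < rot w \<bullet> x" for x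
  proof (rule halving_sides[OF P(1,2) _ _ _ left that])
    show "card (C1 \<union> C2) = card (C3 \<union> C0)"
      using fin disj card by (subst (1 2) card_Un_disjoint) auto
  qed (use P disj in blast)+
  have "{x\<in>P. 0 < rot w \<bullet> x \<and> t < w \<bullet> x} \<subseteq> C1"
    using L upper(2) by force
  from card_mono[OF fin(2) this] have "card {x\<in>P. 0 < rot w \<bullet> x \<and> t < w \<bullet> x} \<le> k"
    by (simp only: card)
  moreover have "C0 \<subseteq> {x\<in>P. rot w \<bullet> x \<le> 0 \<and> t \<le> w \<bullet> x}"
  proof
    fix x assume x: "x \<in> C0"
    then have "x \<notin> C1 \<union> C2"
      using disj by blast
    then show "x \<in> {x\<in>P. rot w \<bullet> x \<le> 0 \<and> t \<le> w \<bullet> x}"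
      using x L[of x] upper(1)[of x] P(3) by (auto simp: not_less[symmetric])
  qed
  then have "k \<le> card {x\<in>P. rot w \<bullet> x \<le> 0 \<and> t \<le> w \<bullet> x}"
    using card_mono[of "{x\<in>P. rot w \<bullet> x \<le> 0 \<and> t \<le> w \<bullet> x}" C0] P(1) card by simp
  ultimately show ?thesis
    unfolding left_heavy_def using not_less by blast
qed

text \<open>The second normal \<open>w'\<close> may have either orientation and any length: in the
  plane, \<open>rot w\<close> is a multiple of it.\<close>

lemma quarters_not_left_heavy:
  fixes P :: "(real^2) set"
  assumes P: "finite P" "uminus ` P = P" "C0 \<union> C1 \<union> C2 \<union> C3 = P"
    and disj: "C0 \<inter> C1 = {}" "C0 \<inter> C2 = {}" "C0 \<inter> C3 = {}" "C1 \<inter> C2 = {}" "C1 \<inter> C3 = {}"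
      "C2 \<inter> C3 = {}"
    and card: "card C0 = k" "card C1 = k" "card C2 = l" "card C3 = l"
    and w: "w \<noteq> 0" "w \<bullet> w' = 0"
    and upper: "\<And>x. x \<in> C0 \<union> C1 \<Longrightarrow> w \<bullet> p \<le> w \<bullet> x" "\<And>x. x \<in> C2 \<union> C3 \<Longrightarrow> w \<bullet> x \<le> w \<bullet> p"
    and left: "\<And>x. x \<in> C1 \<union> C2 \<Longrightarrow> w' \<bullet> p \<le> w' \<bullet> x" "\<And>x. x \<in> C3 \<union> C0 \<Longrightarrow> w' \<bullet> x \<le> w' \<bullet> p"
    and "w' \<noteq> 0"
  shows "\<not> left_heavy k P w"
proof -
  define \<mu> where "\<mu> = (rot w \<bullet> w') / (w' \<bullet> w')"
  have rot_w: "rot w = \<mu> *\<^sub>R w'"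
  proof -
    have "w' \<bullet> w' \<noteq> 0" using \<open>w' \<noteq> 0\<close> by simp
    moreover have "(w' \<bullet> w') *\<^sub>R rot w = (rot w \<bullet> w') *\<^sub>R w'"
    proof -
      have "- ((c * c + d * d) * b) = (a * d - b * c) * c" if "a * c + b * d = 0" for a b c d :: real
        using that by Groebner_Basis.algebra
      moreover have "(c * c + d * d) * a = (a * d - b * c) * d" if "a * c + b * d = 0" for a b c d :: real
        using that by Groebner_Basis.algebra
      ultimately show ?thesis
        using w(2) by (simp add: vec_eq_real2 inner_real2)
    qed
    ultimately show ?thesis
      unfolding \<mu>_def by (metis (no_types) divide_inverse_commute inverse_eq_divide
          scaleR_scaleR scaleR_one left_inverse)
  qed
  show ?thesis
  proof (cases "0 \<le> \<mu>")
    case True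
    show ?thesis
    proof (rule cap_not_left_heavy[OF P disj card upper])
      show "\<mu> * (w' \<bullet> p) \<le> rot w \<bullet> x" if "x \<in> C1 \<union> C2" for x
        unfolding rot_w inner_scaleR_left using left(1)[OF that] True by (rule mult_left_mono)
      show "rot w \<bullet> x \<le> \<mu> * (w' \<bullet> p)" if "x \<in> C3 \<union> C0" for x
        unfolding rot_w inner_scaleR_left using left(2)[OF that] True by (rule mult_left_mono)
    qed
  next
    case False
    \<comment> \<open>A negative factor exchanges left and right, so \<open>C0\<close> is swapped
      with \<open>C1\<close> and \<open>C2\<close> with \<open>C3\<close>.\<close>
    show ?thesis
    proof (rule cap_not_left_heavy[of P C1 C0 C3 C2 k l])
      show "\<mu> * (w' \<bullet> p) \<le> rot w \<bullet> x" if "x \<in> C0 \<union> C3" for x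
        unfolding rot_w inner_scaleR_left
        using that False by (intro mult_left_mono_neg left(2)) auto
      show "rot w \<bullet> x \<le> \<mu> * (w' \<bullet> p)" if "x \<in> C2 \<union> C1" for x
        unfolding rot_w inner_scaleR_left
        using that False by (intro mult_left_mono_neg left(1)) auto
    qed (use P disj card upper in blast)+
  qed
qed

section \<open>Sectors, and the direction obtained from a weak partition\<close>

text \<open>The sums \<open>0 + 1\<close> to \<open>3 + 1\<close> stay unevaluated so as to match
  \<open>ray_dir u v (j + 1)\<close> at a concrete \<open>j\<close>.\<close>

lemma ray_dir_simps:
  "ray_dir u v 0 = u" "ray_dir u v (0 + 1) = v" "ray_dir u v 1 = v" "ray_dir u v (1 + 1) = - u"
  "ray_dir u v 2 = - u" "ray_dir u v (2 + 1) = - v" "ray_dir u v 3 = - v" "ray_dir u v (3 + 1) = u"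
  by (simp_all add: ray_dir_def)

lemma ray_dir_orthogonal:
  assumes "perp_directions u v"
  shows "ray_dir u v j \<noteq> 0" "ray_dir u v (j + 1) \<noteq> 0" "ray_dir u v j \<bullet> ray_dir u v (j + 1) = 0"
proof -
  have "j mod 4 < 4" by simp
  then have "j mod 4 \<in> {0, 1, 2, 3}" by auto
  then show "ray_dir u v j \<noteq> 0" "ray_dir u v (j + 1) \<noteq> 0" "ray_dir u v j \<bullet> ray_dir u v (j + 1) = 0"
    using assms
    by (auto simp: ray_dir_def perp_directions_def orthogonal_def inner_commute mod_Suc)
qed

text \<open>The two rays are orthogonal, so the sector lies in an intersection of two closed
  half-planes, which then contains its closure too.\<close>

lemma closure_sector:
  assumes "perp_directions u v" "x \<in> closure (sector p u v j)"
  shows "ray_dir u v j \<bullet> p \<le> ray_dir u v j \<bullet> x \<and> ray_dir u v (j + 1) \<bullet> p \<le> ray_dir u v (j + 1) \<bullet> x"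
proof -
  let ?a = "ray_dir u v j" and ?b = "ray_dir u v (j + 1)"
  have "sector p u v j \<subseteq> {x. ?a \<bullet> p \<le> ?a \<bullet> x} \<inter> {x. ?b \<bullet> p \<le> ?b \<bullet> x}"
    using ray_dir_orthogonal(3)[OF assms(1), of j]
    by (auto simp: sector_def inner_add_right inner_commute)
  moreover have "closed ({x. ?a \<bullet> p \<le> ?a \<bullet> x} \<inter> {x. ?b \<bullet> p \<le> ?b \<bullet> x})"
    by (intro closed_Int closed_halfspace_ge)
  ultimately have "closure (sector p u v j) \<subseteq> {x. ?a \<bullet> p \<le> ?a \<bullet> x} \<inter> {x. ?b \<bullet> p \<le> ?b \<bullet> x}"
    by (rule closure_minimal)
  with assms(2) show ?thesis by blast
qed

lemma cyclic_sizes_iff: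
  "cyclic_sizes c k l \<longleftrightarrow>
     c 0 = k \<and> c 1 = k \<and> c 2 = l \<and> c 3 = l
     \<or> c 1 = k \<and> c 2 = k \<and> c 3 = l \<and> c 0 = l
     \<or> c 2 = k \<and> c 3 = k \<and> c 0 = l \<and> c 1 = l
     \<or> c 3 = k \<and> c 0 = k \<and> c 1 = l \<and> c 2 = l"
proof -
  have "r < 4 \<longleftrightarrow> r = 0 \<or> r = 1 \<or> r = 2 \<or> r = 3" for r :: nat by linarith
  then have "(\<exists>r<4. Q r) \<longleftrightarrow> Q 0 \<or> Q 1 \<or> Q 2 \<or> Q 3" for Q :: "nat \<Rightarrow> bool"
    by metis
  moreover have "(0 + 1) mod 4 = (1 :: nat)" "(0 + 2) mod 4 = (2 :: nat)" "(0 + 3) mod 4 = (3 :: nat)"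
    "(1 + 1) mod 4 = (2 :: nat)" "(1 + 2) mod 4 = (3 :: nat)" "(1 + 3) mod 4 = (0 :: nat)"
    "(2 + 1) mod 4 = (3 :: nat)" "(2 + 2) mod 4 = (0 :: nat)" "(2 + 3) mod 4 = (1 :: nat)"
    "(3 + 1) mod 4 = (0 :: nat)" "(3 + 2) mod 4 = (1 :: nat)" "(3 + 3) mod 4 = (2 :: nat)"
    by simp_all
  ultimately show ?thesis
    unfolding cyclic_sizes_def by (simp only:)
qed

text \<open>The direction \<open>w\<close> is normal to the line that separates the classes of size
  \<open>k\<close> from the others and points to the side of the former. Each of the four starting
  sectors yields one of \<open>v\<close>, \<open>- u\<close>, \<open>- v\<close>,
  \<open>u\<close>.\<close>

lemma weak_partition_not_left_heavy:
  assumes P: "finite P" "uminus ` P = P" and weak: "has_weak_orthogonal_partition k P"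
  shows "\<exists>w. w \<noteq> 0 \<and> \<not> left_heavy k P w"
proof -
  obtain p u v f where uv: "perp_directions u v" and f: "sector_assignment P p u v f"
    and sizes: "cyclic_sizes (\<lambda>j. card {x\<in>P. f x = j}) k (card P div 2 - k)"
    using weak unfolding has_weak_orthogonal_partition_def by blast
  define C where "C j = {x\<in>P. f x = j}" for j
  have C: "ray_dir u v j \<bullet> p \<le> ray_dir u v j \<bullet> x"
    "ray_dir u v (j + 1) \<bullet> p \<le> ray_dir u v (j + 1) \<bullet> x" if "x \<in> C j" for x j
    using that f closure_sector[OF uv] by (auto simp: C_def sector_assignment_def)
  have "f x \<in> {0, 1, 2, 3}" if "x \<in> P" for x
    using that f by (auto simp: sector_assignment_def)
  then have "C 0 \<union> C 1 \<union> C 2 \<union> C 3 = P"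
    by (auto simp: C_def)
  then have cover: "C 0 \<union> C 1 \<union> C 2 \<union> C 3 = P" "C 1 \<union> C 2 \<union> C 3 \<union> C 0 = P"
    "C 2 \<union> C 3 \<union> C 0 \<union> C 1 = P" "C 3 \<union> C 0 \<union> C 1 \<union> C 2 = P"
    by blast+
  have disj: "C i \<inter> C j = {}" if "i \<noteq> j" for i j
    using that by (auto simp: C_def)
  have uv': "u \<noteq> 0" "v \<noteq> 0" "u \<bullet> v = 0" "v \<bullet> u = 0"
    using uv by (auto simp: perp_directions_def orthogonal_def inner_commute)
  have bounds:
    "x \<in> C 0 \<Longrightarrow> u \<bullet> p \<le> u \<bullet> x \<and> v \<bullet> p \<le> v \<bullet> x"
    "x \<in> C 1 \<Longrightarrow> u \<bullet> x \<le> u \<bullet> p \<and> v \<bullet> p \<le> v \<bullet> x"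
    "x \<in> C 2 \<Longrightarrow> u \<bullet> x \<le> u \<bullet> p \<and> v \<bullet> x \<le> v \<bullet> p"
    "x \<in> C 3 \<Longrightarrow> u \<bullet> p \<le> u \<bullet> x \<and> v \<bullet> x \<le> v \<bullet> p" for x
    using C[of x 0, unfolded ray_dir_simps] C[of x 1, unfolded ray_dir_simps]
      C[of x 2, unfolded ray_dir_simps] C[of x 3, unfolded ray_dir_simps]
    by simp_all
  consider "card (C 0) = k" "card (C 1) = k" "card (C 2) = card P div 2 - k" "card (C 3) = card P div 2 - k"
    | "card (C 1) = k" "card (C 2) = k" "card (C 3) = card P div 2 - k" "card (C 0) = card P div 2 - k"
    | "card (C 2) = k" "card (C 3) = k" "card (C 0) = card P div 2 - k" "card (C 1) = card P div 2 - k"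
    | "card (C 3) = k" "card (C 0) = k" "card (C 1) = card P div 2 - k" "card (C 2) = card P div 2 - k"
    using sizes unfolding cyclic_sizes_iff C_def by blast
  then show ?thesis
  proof cases
    case 1
    have "\<not> left_heavy k P v"
      by (rule quarters_not_left_heavy[OF P cover(1) disj disj disj disj disj disj 1, of v "- u" p])
        (use uv' bounds in auto)
    then show ?thesis using uv' by blast
  next
    case 2
    have "\<not> left_heavy k P (- u)"
      by (rule quarters_not_left_heavy[OF P cover(2) disj disj disj disj disj disj 2, of "- u" "- v" p])
        (use uv' bounds in auto)
    then show ?thesis using uv' by (metis neg_equal_0_iff_equal)
  next
    case 3
    have "\<not> left_heavy k P (- v)"
      by (rule quarters_not_left_heavy[OF P cover(3) disj disj disj disj disj disj 3, of "- v" u p])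
        (use uv' bounds in auto)
    then show ?thesis using uv' by (metis neg_equal_0_iff_equal)
  next
    case 4
    have "\<not> left_heavy k P u"
      by (rule quarters_not_left_heavy[OF P cover(4) disj disj disj disj disj disj 4, of u v p])
        (use uv' bounds in auto)
    then show ?thesis using uv' by blast
  qed
qed

section \<open>Strict partitions as weak ones\<close>

lemma real2_orthogonal_expansion:
  fixes u v p x :: "real^2"
  assumes "u \<noteq> 0" "v \<noteq> 0" "u \<bullet> v = 0"
  obtains a b where "x = p + a *\<^sub>R u + b *\<^sub>R v"
proof -
  define A B where "A = u \<bullet> (x - p) / (u \<bullet> u)" and "B = v \<bullet> (x - p) / (v \<bullet> v)"
  define y where "y = (x - p) - A *\<^sub>R u - B *\<^sub>R v"
  have orth: "u \<bullet> y = 0" "v \<bullet> y = 0"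
    using assms by (simp_all add: y_def A_def B_def inner_diff_right[of _ "x - p - _"]
        inner_diff_right[of _ "x - p"] inner_commute[of v u])
  have "x1 = 0 \<and> x2 = 0"
    if "a * c + b * d = 0" "a * x1 + b * x2 = 0" "c * x1 + d * x2 = 0"
      "a * a + b * b \<noteq> 0" "c * c + d * d \<noteq> 0" for a b c d x1 x2 :: real
  proof -
    have "(a * d - b * c) * x1 = 0"
      using that(2,3) by Groebner_Basis.algebra
    moreover have "(a * d - b * c) * x2 = 0"
      using that(2,3) by Groebner_Basis.algebra
    \<comment> \<open>Lagrange's identity: for orthogonal nonzero vectors the determinant does not
      vanish, so the residual \<open>y\<close>, orthogonal to both, is zero.\<close>
    moreover have "(a * d - b * c)\<^sup>2 = (a * a + b * b) * (c * c + d * d)"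
      using that(1) by Groebner_Basis.algebra
    ultimately show ?thesis
      using that(4,5) by auto
  qed
  from this[of "u $ 1" "v $ 1" "u $ 2" "v $ 2" "y $ 1" "y $ 2"] have "y = 0"
    using assms orth unfolding inner_eq_zero_iff[symmetric, of u] inner_eq_zero_iff[symmetric, of v]
    by (simp add: inner_real2[of _ _] vec_eq_real2[of y])
  then have "x = p + A *\<^sub>R u + B *\<^sub>R v"
    by (simp add: y_def algebra_simps)
  then show ?thesis
    by (rule that)
qed

lemma mem_sector_iff:
  assumes "perp_directions u v"
  shows "x \<in> sector p u v j \<longleftrightarrow> 0 < ray_dir u v j \<bullet> (x - p) \<and> 0 < ray_dir u v (j + 1) \<bullet> (x - p)"
proof -
  let ?a = "ray_dir u v j" and ?b = "ray_dir u v (j + 1)"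
  note ab = ray_dir_orthogonal[OF assms, of j]
  show ?thesis
  proof
    assume "0 < ?a \<bullet> (x - p) \<and> 0 < ?b \<bullet> (x - p)"
    moreover obtain s t where st: "x = p + s *\<^sub>R ?a + t *\<^sub>R ?b"
      using real2_orthogonal_expansion[OF ab] .
    ultimately have "0 < s \<and> 0 < t"
      using ab inner_commute[of ?b ?a] inner_gt_zero_iff[of ?a] inner_gt_zero_iff[of ?b]
      by (auto simp: inner_add_right zero_less_mult_iff simp del: inner_gt_zero_iff)
    with st show "x \<in> sector p u v j"
      unfolding sector_def by blast
  qed (use ab in \<open>auto simp: sector_def inner_add_right inner_diff_right inner_commute\<close>)
qed

lemma strict_imp_weak_partition:
  assumes "has_strict_orthogonal_partition k P"
  shows "has_weak_orthogonal_partition k P"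
proof -
  obtain p u v where uv: "perp_directions u v"
    and avoid: "P \<inter> (line_through p u \<union> line_through p v) = {}"
    and sizes: "cyclic_sizes (\<lambda>j. card (P \<inter> sector p u v j)) k (card P div 2 - k)"
    using assms unfolding has_strict_orthogonal_partition_def by blast
  \<comment> \<open>The signs of the two products identify the open sector. A zero product is
    treated as negative, but does not occur on \<open>P\<close>, which avoids both lines.\<close>
  define f where "f x = (if 0 < u \<bullet> (x - p) then if 0 < v \<bullet> (x - p) then 0 else 3
    else if 0 < v \<bullet> (x - p) then 1 else 2 :: nat)" for x
  have f_lt: "f x < 4" for x
    by (simp add: f_def)
  have off_lines: "u \<bullet> (x - p) \<noteq> 0 \<and> v \<bullet> (x - p) \<noteq> 0" if "x \<in> P" for x
  proof -
    have nz: "u \<noteq> 0" "v \<noteq> 0" "u \<bullet> v = 0"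
      using uv by (auto simp: perp_directions_def orthogonal_def)
    then obtain s t where st: "x = p + s *\<^sub>R u + t *\<^sub>R v"
      by (rule real2_orthogonal_expansion)
    have "s \<noteq> 0"
      using st that avoid by (auto simp: line_through_def disjoint_iff image_iff)
    moreover have "t \<noteq> 0"
      using st that avoid by (auto simp: line_through_def disjoint_iff image_iff)
    ultimately show ?thesis
      unfolding st using nz by (simp add: inner_add_right inner_commute[of v u])
  qed
  have f_iff: "f x = j \<longleftrightarrow> x \<in> sector p u v j" if "x \<in> P" "j < 4" for x j
  proof -
    have "j = 0 \<or> j = 1 \<or> j = 2 \<or> j = 3" using \<open>j < 4\<close> by auto
    then show ?thesis
      unfolding mem_sector_iff[OF uv] using off_lines[OF \<open>x \<in> P\<close>]
      by (elim disjE) (simp_all only: ray_dir_simps, auto simp: f_def)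
  qed
  have "sector_assignment P p u v f"
    unfolding sector_assignment_def using f_lt f_iff closure_subset by blast
  moreover have "{x\<in>P. f x = j} = P \<inter> sector p u v j" if "j < 4" for j
    using f_iff that by auto
  then have "cyclic_sizes (\<lambda>j. card {x\<in>P. f x = j}) k (card P div 2 - k)"
    using sizes unfolding cyclic_sizes_def by (auto cong: conj_cong)
  ultimately show ?thesis
    unfolding has_weak_orthogonal_partition_def using uv by blast
qed

section \<open>Points on a circle modulo a prime\<close>

text \<open>That is, -1 is not a square modulo \<open>p\<close>. Otherwise raise
  \<open>x\<^sup>2 = - y\<^sup>2\<close> to the odd power \<open>(p - 1) div 2\<close>; by Fermat
  both \<open>(p - 1)\<close>-th powers are 1, so \<open>p\<close> divides 2.\<close>

lemma prime_dvd_sum_squares: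
  fixes p :: nat and x y :: int
  assumes p: "prime p" "p mod 4 = 3" and dvd: "int p dvd x\<^sup>2 + y\<^sup>2"
  shows "int p dvd x \<and> int p dvd y"
proof -
  define h where "h = (p - 1) div 2"
  have h: "odd h" "p - 1 = 2 * h"
    using p(2) unfolding h_def by presburger+
  have fermat: "[z ^ (p - 1) = 1] (mod int p)" if "\<not> int p dvd z" for z :: int
  proof -
    have "\<not> p dvd nat \<bar>z\<bar>" using that by simp
    from fermat_theorem[OF p(1) this] have "[int (nat \<bar>z\<bar> ^ (p - 1)) = int 1] (mod int p)"
      by (simp only: cong_int_iff)
    then show ?thesis using h by (simp add: power_mult)
  qed
  have "int p dvd x \<or> int p dvd y"
  proof (rule ccontr)
    assume "\<not> (int p dvd x \<or> int p dvd y)"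
    then have "[x ^ (p - 1) + y ^ (p - 1) = 1 + 1] (mod int p)"
      by (intro cong_add fermat) auto
    moreover have "[x\<^sup>2 = - y\<^sup>2] (mod int p)"
      using dvd by (simp add: cong_iff_dvd_diff)
    from cong_pow[OF this, of h] have "[x ^ (p - 1) + y ^ (p - 1) = 0] (mod int p)"
      using h by (simp add: power_mult cong_iff_dvd_diff)
    ultimately have "int p dvd 2"
      by (metis cong_0_iff cong_sym cong_trans one_add_one)
    then have "p dvd 2" by presburger
    then show False using p(2) dvd_imp_le[of p 2] by (auto simp: le_Suc_eq numeral_2_eq_2)
  qed
  then have "int p dvd x\<^sup>2 \<or> int p dvd y\<^sup>2"
    by (auto simp: power2_eq_square)
  then have "int p dvd x\<^sup>2 \<and> int p dvd y\<^sup>2"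
    using dvd dvd_add_right_iff dvd_add_left_iff by blast
  moreover have "prime (int p)" using p by simp
  ultimately show ?thesis
    using prime_dvd_power by blast
qed

text \<open>The squared sides of a triangle with circumradius \<open>R\<close> and area \<open>F\<close> have the product
  \<open>16 R\<^sup>2 F\<^sup>2\<close>, also modulo \<open>p\<close>. When \<open>F = 0\<close>, a side thus vanishes modulo \<open>p\<close>.\<close>

lemma collinear_on_circle_mod_prime:
  fixes p :: nat and a1 a2 b1 b2 c1 c2 r :: int
  assumes p: "prime p" "p mod 4 = 3"
    and a: "[a1\<^sup>2 + a2\<^sup>2 = r] (mod p)"
    and b: "[b1\<^sup>2 + b2\<^sup>2 = r] (mod p)"
    and c: "[c1\<^sup>2 + c2\<^sup>2 = r] (mod p)"
    and det: "(b1 - a1) * (c2 - a2) = (b2 - a2) * (c1 - a1)"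
  shows "[a1 = b1] (mod p) \<and> [a2 = b2] (mod p) \<or> [a1 = c1] (mod p) \<and> [a2 = c2] (mod p)
    \<or> [b1 = c1] (mod p) \<and> [b2 = c2] (mod p)"
proof -
  define d1 d2 e1 e2 where d: "d1 = b1 - a1" "d2 = b2 - a2" and e: "e1 = c1 - a1" "e2 = c2 - a2"
  \<comment> \<open>\<open>X + D\<close> and \<open>Y + E\<close> are the differences of squared
    norms, so modulo \<open>p\<close> the numbers \<open>X\<close>, \<open>Y\<close> are
    \<open>- D\<close>, \<open>- E\<close>.\<close>
  define X Y where X: "X = 2 * (a1 * d1 + a2 * d2)" and Y: "Y = 2 * (a1 * e1 + a2 * e2)"
  define D E I where D: "D = d1\<^sup>2 + d2\<^sup>2" and E: "E = e1\<^sup>2 + e2\<^sup>2" and I: "I = d1 * e1 + d2 * e2"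
  have det': "d1 * e2 = d2 * e1" using det by (simp add: d e)
  have "int p dvd (b1\<^sup>2 + b2\<^sup>2) - (a1\<^sup>2 + a2\<^sup>2)" "int p dvd (c1\<^sup>2 + c2\<^sup>2) - (a1\<^sup>2 + a2\<^sup>2)"
    using a b c by (meson cong_iff_dvd_diff cong_sym cong_trans)+
  moreover have "(b1\<^sup>2 + b2\<^sup>2) - (a1\<^sup>2 + a2\<^sup>2) = X + D" "(c1\<^sup>2 + c2\<^sup>2) - (a1\<^sup>2 + a2\<^sup>2) = Y + E"
    by (simp_all add: X Y D E d e power2_eq_square algebra_simps)
  ultimately have XD: "int p dvd X + D" and YE: "int p dvd Y + E" by simp_all
  \<comment> \<open>The left side is the squared norm of \<open>X e - Y d\<close>, which vanishes
    because \<open>d\<close> and \<open>e\<close> are parallel.\<close>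
  have gram: "X\<^sup>2 * E - 2 * X * Y * I + Y\<^sup>2 * D = 0"
    unfolding X Y D E I using det' by Groebner_Basis.algebra
  \<comment> \<open>Putting \<open>- D\<close>, \<open>- E\<close> for \<open>X\<close>,
    \<open>Y\<close> in \<open>gram\<close> gives the product of the three squared sides; the
    cofactors below make this divisibility explicit.\<close>
  have "D * E * (D + E - 2 * I) =
      (D * E * (D + E - 2 * I)) - (X\<^sup>2 * E - 2 * X * Y * I + Y\<^sup>2 * D)"
    using gram by simp
  also have "\<dots> = (X + D) * (E * (D - X) - 2 * I * E) + (Y + E) * (D * (E - Y) + 2 * I * X)"
    by (simp add: power2_eq_square algebra_simps)
  finally have "int p dvd D * E * (D + E - 2 * I)"
    using XD YE by simp
  moreover have "D + E - 2 * I = (d1 - e1)\<^sup>2 + (d2 - e2)\<^sup>2"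
    by (simp add: D E I power2_eq_square algebra_simps)
  moreover have "prime (int p)" using p by simp
  ultimately consider "int p dvd d1\<^sup>2 + d2\<^sup>2" | "int p dvd e1\<^sup>2 + e2\<^sup>2"
    | "int p dvd (d1 - e1)\<^sup>2 + (d2 - e2)\<^sup>2"
    by (metis D E prime_dvd_mult_iff)
  then show ?thesis
  proof cases
    case 1
    from prime_dvd_sum_squares[OF p this] show ?thesis
      by (simp add: d cong_iff_dvd_diff dvd_diff_commute)
  next
    case 2
    from prime_dvd_sum_squares[OF p this] show ?thesis
      by (simp add: e cong_iff_dvd_diff dvd_diff_commute)
  next
    case 3
    from prime_dvd_sum_squares[OF p this] show ?thesis
      by (simp add: d e cong_iff_dvd_diff)
  qed
qed

section \<open>The point set\<close>

definition base_points :: "(int \<times> int) list" where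
  "base_points =
    [(2995, 1781), (2871, 1332), (1623, -2234), (2509, 818), (2037, 655), (2027, 393),
     (1795, 329), (1306, -118), (1147, -340), (544, 929), (694, 784), (666, 792), (679, 775),
     (689, 763), (707, 741), (701, 742), (692, 742), (686, 741), (1009, 2), (709, 715),
     (794, 583), (898, 386), (833, 403), (718, -420)]"

text \<open>Orbits under the quarter turn, kept as integer pairs so that all numerical checks can be
  evaluated.\<close>

definition points :: "(int \<times> int) list" where
  "points = concat (map (\<lambda>(x, y). [(x, y), (- y, x), (- x, - y), (y, - x)]) base_points)"

definition to_vec :: "int \<times> int \<Rightarrow> real^2" where
  "to_vec q = vector [of_int (fst q), of_int (snd q)]"

lemma to_vec_nth [simp]: "to_vec q $ 1 = of_int (fst q)" "to_vec q $ 2 = of_int (snd q)"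
  by (simp_all add: to_vec_def)

lemma inj_to_vec: "inj to_vec"
  by (rule injI) (simp add: vec_eq_real2 prod_eq_iff)

definition point_set :: "(real^2) set" where
  "point_set = to_vec ` set points"

text \<open>Incongruence modulo 199, and not just distinctness, is what excludes collinear
  triples.\<close>

lemma distinct_points_mod: "distinct (map (\<lambda>(x, y). (x mod 199, y mod 199)) points)"
  by code_simp

lemma distinct_points: "distinct points"
  using distinct_points_mod by (simp add: distinct_map)

lemma points_on_circle: "\<forall>(x, y)\<in>set points. (x * x + y * y) mod 199 = 1"
  by code_simp

lemma prime_199: "prime (199 :: nat)"
  by (simp add: prime_nat_numeral_eq)

text \<open>In \<open>(k, s, k', s')\<close> the numbers \<open>k\<close>, \<open>k'\<close> stand for the directions \<open>(100 - k, k)\<close> and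
  \<open>(100 - k', k')\<close> that span the cone, and \<open>s\<close>, \<open>s'\<close> for heights in these two directions. By
  linear interpolation they give a height for every direction of the cone that is reached by at
  least nine points on the left and by at most seven others.\<close>

definition cones :: "(int \<times> int \<times> int \<times> int) list" where
  "cones =
    [(0, 83300, 15, 76850), (15, 70990, 24, 71516), (24, 70204, 30, 71120),
     (30, 70780, 37, 71122), (37, 71122, 42, 70538), (42, 70910, 50, 71200),
     (50, 72700, 53, 72988), (53, 74764, 63, 78655), (63, 80691, 77, 96139),
     (77, 77647, 91, 91801), (91, 78244, 100, 89800)]"

section \<open>Certificates for cones of directions\<close>

definition dot :: "int \<Rightarrow> int \<times> int \<Rightarrow> int" where
  "dot k q = (100 - k) * fst q + k * snd q"

text \<open>The inner product with \<open>(- k, 100 - k)\<close>, the quarter turn of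
  \<open>(100 - k, k)\<close>; it is positive on the left.\<close>

definition cross :: "int \<Rightarrow> int \<times> int \<Rightarrow> int" where
  "cross k q = (100 - k) * snd q - k * fst q"

text \<open>Tests at the two bounding directions control the whole cone. The first list contains
  only points that are left and high throughout; the second contains every point that is right and
  high for some direction between.\<close>

definition good_cone :: "int \<times> int \<times> int \<times> int \<Rightarrow> bool" where
  "good_cone = (\<lambda>(k, s, k', s'). k < k' \<and>
     8 < length (filter (\<lambda>q. 0 < cross k q \<and> 0 < cross k' q \<and> s \<le> dot k q \<and> s' \<le> dot k' q) points)
     \<and> length (filter (\<lambda>q. \<not> (0 < cross k q \<and> 0 < cross k' q)
                           \<and> \<not> (dot k q < s \<and> dot k' q < s')) points) < 8)"

lemma good_cones: "\<forall>c\<in>set cones. good_cone c"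
  by code_simp

text \<open>Inner products with \<open>w\<close> interpolate those at the ends with weights
  \<open>a\<close>, \<open>b\<close>, as \<open>h\<close> does the heights. For \<open>t < h\<close>
  all points of \<open>A\<close>, at least nine, are counted on the left; for
  \<open>h \<le> t\<close> the points counted on the right are all in \<open>B\<close>.\<close>

lemma good_cone_left_heavy:
  assumes cone: "good_cone (k, s, k', s')"
    and ab: "0 \<le> a" "0 \<le> b" "0 < a + b"
    and w: "w $ 1 = a * (100 - real_of_int k) + b * (100 - real_of_int k')"
      "w $ 2 = a * real_of_int k + b * real_of_int k'"
  shows "left_heavy 8 point_set w"
proof -
  define h where "h = a * s + b * s'"
  have upper: "w \<bullet> to_vec q = a * dot k q + b * dot k' q"
    and left: "rot w \<bullet> to_vec q = a * cross k q + b * cross k' q" for q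
    by (simp_all add: inner_real2 w dot_def cross_def algebra_simps)
  \<comment> \<open>Strictness survives interpolation because \<open>a\<close> and \<open>b\<close>
    are not both zero.\<close>
  have less: "a * real_of_int x + b * real_of_int x' < a * real_of_int y + b * real_of_int y'"
    if "x < y" "x' < y'" for x x' y y'
  proof (cases "a = 0")
    case True
    then show ?thesis using that ab by simp
  next
    case False
    then show ?thesis using that ab by (intro add_less_le_mono mult_strict_left_mono mult_left_mono) auto
  qed
  define A where "A = filter (\<lambda>q. 0 < cross k q \<and> 0 < cross k' q \<and> s \<le> dot k q \<and> s' \<le> dot k' q) points"
  define B where "B = filter (\<lambda>q. \<not> (0 < cross k q \<and> 0 < cross k' q)
                                 \<and> \<not> (dot k q < s \<and> dot k' q < s')) points"
  have "card (to_vec ` set A) = length A" "card (to_vec ` set B) = length B"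
    unfolding A_def B_def
    by (simp_all only: card_image inj_on_subset[OF inj_to_vec] subset_UNIV
        distinct_card distinct_filter distinct_points)
  then have cards: "8 < card (to_vec ` set A)" "card (to_vec ` set B) < 8"
    using cone by (simp_all only: good_cone_def prod.case A_def B_def)
  show ?thesis
    unfolding left_heavy_def
  proof (intro allI impI)
    fix t
    let ?L = "{x \<in> point_set. 0 < rot w \<bullet> x \<and> t < w \<bullet> x}"
    let ?R = "{x \<in> point_set. rot w \<bullet> x \<le> 0 \<and> t \<le> w \<bullet> x}"
    assume few: "card ?L \<le> 8"
    have "h \<le> t"
    proof (rule ccontr)
      assume "\<not> h \<le> t"
      have "0 < rot w \<bullet> to_vec q \<and> t < w \<bullet> to_vec q" if "q \<in> set A" for q
      proof -
        have "h \<le> w \<bullet> to_vec q"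
          using that ab unfolding h_def upper A_def by (intro add_mono mult_left_mono) auto
        moreover have "0 < rot w \<bullet> to_vec q"
          using that less[of 0 "cross k q" 0 "cross k' q"] unfolding left A_def by simp
        ultimately show ?thesis
          using \<open>\<not> h \<le> t\<close> by simp
      qed
      then have "to_vec ` set A \<subseteq> ?L"
        by (auto simp: A_def point_set_def)
      then have "card (to_vec ` set A) \<le> card ?L"
        by (rule card_mono[rotated]) (simp add: point_set_def)
      then show False
        using few cards(1) by simp
    qed
    have "q \<in> set B" if "q \<in> set points" "rot w \<bullet> to_vec q \<le> 0" "t \<le> w \<bullet> to_vec q" for q
    proof -
      have "\<not> (0 < cross k q \<and> 0 < cross k' q)"
        using that(2) less[of 0 "cross k q" 0 "cross k' q"] unfolding left by auto
      moreover have "\<not> (dot k q < s \<and> dot k' q < s')"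
        using that(3) \<open>h \<le> t\<close> less[of "dot k q" s "dot k' q" s'] unfolding upper h_def by auto
      ultimately show ?thesis
        using that(1) by (simp add: B_def)
    qed
    then have "?R \<subseteq> to_vec ` set B"
      by (auto simp: point_set_def)
    then have "card ?R \<le> card (to_vec ` set B)"
      by (rule card_mono[rotated]) simp
    then show "card ?R < 8"
      using cards(2) by simp
  qed
qed

lemma left_heavy_point_set_quadrant:
  assumes "w \<noteq> 0" "0 \<le> w $ 1" "0 \<le> w $ 2"
  shows "left_heavy 8 point_set w"
proof -
  define m where "m = w $ 1 + w $ 2"
  define z where "z = 100 * (w $ 2) / m"
  have "0 < m"
    using assms by (auto simp: m_def vec_eq_real2 less_le)
  then have w: "w $ 1 = m * (100 - z) / 100" "w $ 2 = m * z / 100"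
    by (simp_all add: z_def m_def field_simps)
  have "0 \<le> z" "z \<le> 100"
    using assms \<open>0 < m\<close> by (simp_all add: z_def m_def field_simps)
  \<comment> \<open>Consecutive cones share an end, so their intervals cover \<open>0\<close> to
    \<open>100\<close>.\<close>
  then have "\<exists>(k, s, k', s')\<in>set cones. real_of_int k \<le> z \<and> z \<le> real_of_int k'"
    by (simp add: cones_def) linarith
  then obtain k s k' s' where cone: "(k, s, k', s') \<in> set cones"
    and z: "real_of_int k \<le> z" "z \<le> real_of_int k'"
    by auto
  have good: "good_cone (k, s, k', s')"
    using good_cones cone by blast
  then have "k < k'"
    by (simp add: good_cone_def)
  define d where "d = real_of_int k' - real_of_int k"
  define c where "c = m / (100 * d)"
  \<comment> \<open>Barycentric weights of \<open>z\<close> between \<open>k\<close> and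
    \<open>k'\<close>, scaled to the total \<open>m / 100\<close>.\<close>
  define a b where "a = c * (real_of_int k' - z)" and "b = c * (z - real_of_int k)"
  have "0 < d"
    using \<open>k < k'\<close> by (simp add: d_def)
  then have "0 < c" and c: "c * d = m / 100"
    using \<open>0 < m\<close> by (simp_all add: c_def)
  have sum: "a + b = m / 100"
    unfolding c[symmetric] by (simp add: a_def b_def d_def algebra_simps)
  have "a * real_of_int k + b * real_of_int k' = c * d * z"
    by (simp add: a_def b_def d_def algebra_simps)
  then have mean: "a * real_of_int k + b * real_of_int k' = m / 100 * z"
    unfolding c .
  show ?thesis
  proof (rule good_cone_left_heavy[OF good, where a = a and b = b])
    show "0 \<le> a" "0 \<le> b"
      using z \<open>0 < c\<close> by (simp_all add: a_def b_def)
    show "0 < a + b"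
      using sum \<open>0 < m\<close> by simp
    show "w $ 2 = a * real_of_int k + b * real_of_int k'"
      using mean w by simp
    have "a * (100 - real_of_int k) + b * (100 - real_of_int k')
        = 100 * (a + b) - (a * real_of_int k + b * real_of_int k')"
      by (simp add: algebra_simps)
    moreover have "w $ 1 = m - w $ 2"
      by (simp add: m_def)
    ultimately show "w $ 1 = a * (100 - real_of_int k) + b * (100 - real_of_int k')"
      unfolding mean sum w(2) by simp
  qed
qed

section \<open>Size, symmetry and general position of the set\<close>

lemma card_point_set: "card point_set = 96"
proof -
  have "length points = 96"
    by code_simp
  then show ?thesis
    by (simp add: point_set_def card_image inj_on_subset[OF inj_to_vec] distinct_card distinct_points)
qed

text \<open>The orbits give one inclusion; an injective self-map of a finite set is onto.\<close>

lemma rot_point_set: "rot ` point_set = point_set"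
proof (rule endo_inj_surj)
  show "rot ` point_set \<subseteq> point_set"
  proof
    fix x assume "x \<in> rot ` point_set"
    then obtain c d where "(c, d) \<in> set points" "x = to_vec (- d, c)"
      by (auto simp: point_set_def vec_eq_real2)
    then show "x \<in> point_set"
      by (force simp: point_set_def points_def)
  qed
qed (auto simp: point_set_def intro: inj_on_subset[OF inj_rot])

lemma uminus_point_set: "uminus ` point_set = point_set"
proof -
  have "uminus x = rot (rot x)" for x
    by (simp add: vec_eq_real2)
  then show ?thesis
    using rot_point_set by (metis image_cong image_image)
qed

lemma no_three_collinear:
  assumes "q \<in> set points" "q' \<in> set points" "q'' \<in> set points"
    and "q \<noteq> q'" "q \<noteq> q''" "q' \<noteq> q''"
  shows "\<not> collinear {to_vec q, to_vec q', to_vec q''}"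
proof
  assume "collinear {to_vec q, to_vec q', to_vec q''}"
  \<comment> \<open>\<open>collinear_3\<close> subtracts the middle point, so
    \<open>to_vec q\<close> is moved there.\<close>
  then have "collinear {to_vec q', to_vec q, to_vec q''}"
    by (simp add: insert_commute)
  then have "collinear {0, to_vec q' - to_vec q, to_vec q'' - to_vec q}"
    by (simp add: collinear_3)
  moreover have "x $ 1 * y $ 2 = x $ 2 * y $ 1" if "collinear {0, x, y}" for x y :: "real^2"
    using that by (auto simp: collinear_lemma)
  ultimately have "(to_vec q' - to_vec q) $ 1 * (to_vec q'' - to_vec q) $ 2
      = (to_vec q' - to_vec q) $ 2 * (to_vec q'' - to_vec q) $ 1"
    by blast
  then have "real_of_int ((fst q' - fst q) * (snd q'' - snd q))
      = real_of_int ((snd q' - snd q) * (fst q'' - fst q))"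
    by simp
  then have det: "(fst q' - fst q) * (snd q'' - snd q) = (snd q' - snd q) * (fst q'' - fst q)"
    by (simp only: of_int_eq_iff)
  have circle: "[(fst z)\<^sup>2 + (snd z)\<^sup>2 = 1] (mod int 199)" if "z \<in> set points" for z
    using points_on_circle that by (auto simp: cong_def power2_eq_square)
  have inj: "inj_on (\<lambda>(x, y). (x mod 199, y mod 199)) (set points)"
    using distinct_points_mod by (simp add: distinct_map)
  have incongruent: "\<not> ([fst z = fst z'] (mod int 199) \<and> [snd z = snd z'] (mod int 199))"
    if "z \<in> set points" "z' \<in> set points" "z \<noteq> z'" for z z'
    using inj_onD[OF inj _ that(1,2)] that(3) by (auto simp: case_prod_beta cong_def)
  then show False
    using collinear_on_circle_mod_prime[OF prime_199 _ circle circle circle det] assms(1-3)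
      incongruent[OF assms(1,2,4)] incongruent[OF assms(1,3,5)] incongruent[OF assms(2,3,6)] by auto
qed

theorem theorem1p6:
  "\<exists>P :: (real^2) set.
     P \<subseteq> integer_lattice
     \<and> finite P \<and> card P = 96
     \<and> uminus ` P = P
     \<and> (\<forall>a\<in>P. \<forall>b\<in>P. \<forall>c\<in>P. a \<noteq> b \<and> a \<noteq> c \<and> b \<noteq> c \<longrightarrow> \<not> collinear {a, b, c})
     \<and> \<not> has_strict_orthogonal_partition 8 P
     \<and> \<not> has_weak_orthogonal_partition 8 P"
proof (intro exI conjI)
  show fin: "finite point_set"
    by (simp add: point_set_def)
  show "card point_set = 96"
    by (rule card_point_set)
  show "uminus ` point_set = point_set"
    by (rule uminus_point_set)
  show "point_set \<subseteq> integer_lattice"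
    by (auto simp: point_set_def integer_lattice_def forall_2)
  show "\<forall>a\<in>point_set. \<forall>b\<in>point_set. \<forall>c\<in>point_set.
      a \<noteq> b \<and> a \<noteq> c \<and> b \<noteq> c \<longrightarrow> \<not> collinear {a, b, c}"
  proof (intro ballI impI)
    fix a b c assume "a \<in> point_set" "b \<in> point_set" "c \<in> point_set" and ne: "a \<noteq> b \<and> a \<noteq> c \<and> b \<noteq> c"
    then obtain q q' q'' where "q \<in> set points" "q' \<in> set points" "q'' \<in> set points"
      and abc: "a = to_vec q" "b = to_vec q'" "c = to_vec q''"
      unfolding point_set_def by blast
    with ne show "\<not> collinear {a, b, c}"
      unfolding abc by (intro no_three_collinear) auto
  qed
  show weak: "\<not> has_weak_orthogonal_partition 8 point_set"
    using weak_partition_not_left_heavy[OF fin uminus_point_set]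
      left_heavy_quadrant[OF rot_point_set left_heavy_point_set_quadrant] by blast
  show "\<not> has_strict_orthogonal_partition 8 point_set"
    using weak strict_imp_weak_partition by blast
qed

end
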